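(* Let $\mathbb{B}$ be a complete Boolean algebra. Then: (a) if $\langle a_n:n\in\omega\rangle$ is a decreasing sequence in $\mathbb{B}$, then $\operatorname{cl}_{\omega_1}(\{a_n:n\in\omega\})=(\bigwedge_{n\in\omega}a_n)\uparrow$; (b) if $\langle a_n:n\in\omega\rangle$ is an increasing sequence in $\mathbb{B}$, then $\operatorname{cl}_{\omega_1}(\{a_n:n\in\omega\})=a_0\uparrow$; (c) if $\{a_n:n\in\omega\}$ is a countably infinite antichain in $\mathbb{B}$, then $\operatorname{cl}_{\omega_1}(\{a_n:n\in\omega\})=\mathbb{B}$; (d) if a set $A\subset\mathbb{B}$ contains an infinite antichain, then $\operatorname{cl}_{\omega_1}(A)=\mathbb{B}$; (e) if $\mathbb{B}$ is infinite and a set $A$ is dense in $\mathbb{B}$, then $\operatorname{cl}_{\omega_1}(A)=\mathbb{B}$.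
   Context: For a sequence $x=\langle x_n:n\in\omega\rangle$ in $\mathbb{B}$, $\limsup x=\bigwedge_{k\in\omega}\bigvee_{n\ge k}x_n$. For $A\subset\mathbb{B}$, $A\uparrow=\{b\in\mathbb{B}:\exists a\in A\ a\le b\}$ and $b\uparrow=\{b\}\uparrow$. Let $u(A)=\bigcup_{y\in A^\omega}(\limsup y)\uparrow$, and define by recursion $\operatorname{cl}_0(A)=A$, $\operatorname{cl}_{\alpha+1}(A)=u(\operatorname{cl}_\alpha(A))$, and $\operatorname{cl}_\gamma(A)=\bigcup_{\alpha<\gamma}\operatorname{cl}_\alpha(A)$ for limit $\gamma\le\omega_1$. The operator $\operatorname{cl}_{\omega_1}$ is the closure operator of the topology $\mathcal{O}^\uparrow$ on $\mathbb{B}$ generated by the convergence $x\mapsto\{\limsup x\}$ ($O$ is open iff for every sequence $x$ in $\mathbb{B}$ with $\limsup x\in O$, $x_n\in O$ for all but finitely many $n$). An antichain is a set of non-zero elements any two different members of which have meet $0$. A set $A$ is dense in $\mathbb{B}$ iff for each $b\in\mathbb{B}$, $b>0$, there is $a\in A$ with $0<a\le b$. A sequence is decreasing (increasing) iff $a_n\ge a_m$ ($a_n\le a_m$) whenever $n\le m$. *)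

theory Defs
  imports "HOL-Library.Liminf_Limsup"
begin

text \<open>
  A complete Boolean algebra is a type of sort \<open>{boolean_algebra, complete_lattice}\<close>. The class
  \<open>complete_boolean_algebra\<close> is deliberately not used: it extends \<open>complete_distrib_lattice\<close>, which
  demands complete distributivity, and hence it only covers the atomic algebras.

  The library function \<open>limsup\<close> is available in every complete lattice, and
  \<open>limsup x = (INF k. SUP n\<in>{k..}. x n)\<close> holds there by \<open>limsup_INF_SUP\<close>.
\<close>

definition upset :: "'b::order set \<Rightarrow> 'b set" where
  "upset A = {b. \<exists>a\<in>A. a \<le> b}"

definition u :: "'b::complete_lattice set \<Rightarrow> 'b set" where
  "u A = (\<Union>y\<in>{y :: nat \<Rightarrow> 'b. \<forall>n. y n \<in> A}. upset {limsup y})"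

text \<open>
  The ordinal \<open>\<omega>\<^sub>1\<close> is represented by the well-order \<open>omega1\<close>; the ordinals below \<open>\<omega>\<^sub>1\<close> are the
  elements of its field. The second conjunct of \<open>is_successor\<close> excludes \<open>\<beta>\<close> outside the field, on
  which \<open>wo_rel.suc\<close> is unspecified.
\<close>

definition omega1 :: "nat set rel" where
  "omega1 = cardSuc natLeq"

definition is_successor :: "nat set \<Rightarrow> nat set \<Rightarrow> bool" where
  "is_successor \<alpha> \<beta> \<longleftrightarrow> \<alpha> = wo_rel.suc omega1 {\<beta>} \<and> \<beta> \<in> underS omega1 \<alpha>"

definition cl :: "nat set \<Rightarrow> 'b::complete_lattice set \<Rightarrow> 'b set" where
  "cl \<alpha> A = wo_rel.worec omega1 (\<lambda>c \<alpha>.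
     if underS omega1 \<alpha> = {} then A
     else if \<exists>\<beta>. is_successor \<alpha> \<beta> then u (c (THE \<beta>. is_successor \<alpha> \<beta>))
     else (\<Union>\<beta>\<in>underS omega1 \<alpha>. c \<beta>)) \<alpha>"

text \<open>The limit case of the recursion at \<open>\<gamma> = \<omega>\<^sub>1\<close>:\<close>

definition cl_omega1 :: "'b::complete_lattice set \<Rightarrow> 'b set" where
  "cl_omega1 A = (\<Union>\<alpha>\<in>Field omega1. cl \<alpha> A)"

definition antichain :: "'b::boolean_algebra set \<Rightarrow> bool" where
  "antichain C \<longleftrightarrow> bot \<notin> C \<and> (\<forall>a\<in>C. \<forall>b\<in>C. a \<noteq> b \<longrightarrow> inf a b = bot)"

definition dense_subset :: "'b::boolean_algebra set \<Rightarrow> bool" where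
  "dense_subset A \<longleftrightarrow> (\<forall>b. bot < b \<longrightarrow> (\<exists>a\<in>A. bot < a \<and> a \<le> b))"

text \<open>The recursion equations of \<open>cl\<close>.\<close>

lemma Card_order_omega1: "Card_order omega1"
  unfolding omega1_def by (rule cardSuc_Card_order[OF natLeq_Card_order])

lemma wo_rel_omega1: "wo_rel omega1"
  using Card_order_omega1 by (simp add: wo_rel_def card_order_on_def)

lemma infinite_Field_omega1: "infinite (Field omega1)"
  unfolding omega1_def
  using cardSuc_finite[OF natLeq_Card_order] by (simp add: Field_natLeq)

lemma is_successor_unique:
  assumes "is_successor \<alpha> \<beta>" "is_successor \<alpha> \<beta>'" shows "\<beta> = \<beta>'"
proof -
  interpret wo_rel omega1 by (rule wo_rel_omega1)
  have aux: "(\<gamma>, \<delta>) \<in> omega1" if d: "is_successor \<alpha> \<delta>" and g: "is_successor \<alpha> \<gamma>" for \<gamma> \<delta>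
  proof (rule ccontr)
    assume n: "(\<gamma>, \<delta>) \<notin> omega1"
    have suc: "\<alpha> = suc {\<delta>}" and below: "(\<delta>, \<alpha>) \<in> omega1" "(\<gamma>, \<alpha>) \<in> omega1" "\<gamma> \<noteq> \<alpha>"
      using d g unfolding is_successor_def underS_def by blast+
    have F: "\<delta> \<in> Field omega1" "\<gamma> \<in> Field omega1"
      using below by (auto intro: FieldI1)
    have "(\<delta>, \<gamma>) \<in> omega1" "\<gamma> \<noteq> \<delta>"
      using n F TOTALS in_notinI by blast+
    then have "\<gamma> \<in> AboveS {\<delta>}"
      using F unfolding AboveS_def by blast
    then have "(\<alpha>, \<gamma>) \<in> omega1"
      unfolding suc by (rule suc_least_AboveS)
    with below show False using ANTISYM unfolding antisym_def by blast
  qed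
  show ?thesis
    using aux[of \<beta> \<beta>'] aux[of \<beta>' \<beta>] assms ANTISYM unfolding antisym_def by blast
qed

lemma cl_rec:
  "cl \<alpha> A = (if underS omega1 \<alpha> = {} then A
     else if \<exists>\<beta>. is_successor \<alpha> \<beta> then u (cl (THE \<beta>. is_successor \<alpha> \<beta>) A)
     else (\<Union>\<beta>\<in>underS omega1 \<alpha>. cl \<beta> A))"
proof -
  let ?H = "\<lambda>c \<alpha>. if underS omega1 \<alpha> = {} then A
     else if \<exists>\<beta>. is_successor \<alpha> \<beta> then u (c (THE \<beta>. is_successor \<alpha> \<beta>))
     else (\<Union>\<beta>\<in>underS omega1 \<alpha>. c \<beta>)"
  have the: "(THE \<beta>. is_successor \<alpha> \<beta>) \<in> underS omega1 \<alpha>" if "is_successor \<alpha> \<beta>" for \<alpha> \<beta>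
  proof -
    have "(THE \<beta>. is_successor \<alpha> \<beta>) = \<beta>"
      using that is_successor_unique by (intro the_equality) blast+
    with that show ?thesis unfolding is_successor_def by metis
  qed
  have "wo_rel.adm_wo omega1 ?H" unfolding wo_rel.adm_wo_def[OF wo_rel_omega1]
  proof (intro allI impI)
    fix f g :: "nat set \<Rightarrow> 'a set" and \<alpha>
    assume eq: "\<forall>\<beta>\<in>underS omega1 \<alpha>. f \<beta> = g \<beta>"
    have sup: "(\<Union>\<beta>\<in>underS omega1 \<alpha>. f \<beta>) = (\<Union>\<beta>\<in>underS omega1 \<alpha>. g \<beta>)"
      using eq by simp
    have suc: "u (f (THE \<beta>. is_successor \<alpha> \<beta>)) = u (g (THE \<beta>. is_successor \<alpha> \<beta>))"
      if ex: "\<exists>\<beta>. is_successor \<alpha> \<beta>"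
    proof -
      from ex the have "(THE \<beta>. is_successor \<alpha> \<beta>) \<in> underS omega1 \<alpha>" by blast
      with eq show ?thesis by metis
    qed
    show "?H f \<alpha> = ?H g \<alpha>"
      by (intro if_cong refl sup suc)
  qed
  from fun_cong[OF wo_rel.worec_fixpoint[OF wo_rel_omega1 this], of \<alpha>] show ?thesis
    unfolding cl_def .
qed

lemma cl_zero: "underS omega1 \<alpha> = {} \<Longrightarrow> cl \<alpha> A = A"
  by (subst cl_rec) simp

lemma is_successor_suc:
  assumes "\<beta> \<in> Field omega1"
  shows "is_successor (wo_rel.suc omega1 {\<beta>}) \<beta>"
proof -
  interpret wo_rel omega1 by (rule wo_rel_omega1)
  obtain \<gamma> where "\<gamma> \<in> Field omega1" "\<beta> \<noteq> \<gamma>" "(\<beta>, \<gamma>) \<in> omega1"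
    using infinite_Card_order_limit[OF Card_order_omega1 infinite_Field_omega1 assms] by blast
  then have "AboveS {\<beta>} \<noteq> {}" by (auto simp: AboveS_def)
  with suc_greater[of "{\<beta>}" \<beta>] assms have "\<beta> \<in> Order_Relation.underS omega1 (suc {\<beta>})"
    unfolding Order_Relation.underS_def by blast
  then show ?thesis unfolding is_successor_def by blast
qed

lemma cl_suc:
  assumes "\<beta> \<in> Field omega1"
  shows "cl (wo_rel.suc omega1 {\<beta>}) A = u (cl \<beta> A)"
proof -
  have s: "is_successor (wo_rel.suc omega1 {\<beta>}) \<beta>" by (rule is_successor_suc[OF assms])
  then have "(THE \<beta>'. is_successor (wo_rel.suc omega1 {\<beta>}) \<beta>') = \<beta>"
    using is_successor_unique by (intro the_equality) blast+
  moreover have "underS omega1 (wo_rel.suc omega1 {\<beta>}) \<noteq> {}"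
    using s unfolding is_successor_def by blast
  moreover have "\<exists>\<beta>'. is_successor (wo_rel.suc omega1 {\<beta>}) \<beta>'"
    using s by blast
  ultimately show ?thesis
    using cl_rec[of "wo_rel.suc omega1 {\<beta>}" A] by presburger
qed

lemma cl_limit:
  assumes "underS omega1 \<alpha> \<noteq> {}" and "\<nexists>\<beta>. is_successor \<alpha> \<beta>"
  shows "cl \<alpha> A = (\<Union>\<beta>\<in>underS omega1 \<alpha>. cl \<beta> A)"
  using assms cl_rec[of \<alpha> A] by presburger

end

theory Submission
  imports Defs
begin

text \<open>
  Every set \<open>S \<supseteq> A\<close> with \<open>u S \<subseteq> S\<close> contains \<open>cl_omega1 A\<close>, and \<open>cl_omega1 A\<close> contains \<open>u A\<close>; in
  all five parts these bounds coincide, so the iteration stops after one step. A principal filter is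
  closed under \<open>u\<close>, which gives the upper bounds in (a) and (b). An injective sequence in an
  antichain has \<open>limsup\<close> \<open>bot\<close>, whose upper set is everything. An infinite algebra has a strictly
  decreasing sequence; the consecutive differences form an antichain, below which a dense set
  contains an infinite antichain of its own.
\<close>

lemma u_mono: "A \<subseteq> B \<Longrightarrow> u A \<subseteq> u B"
  unfolding u_def by blast

lemma u_I: "(\<And>n. y n \<in> A) \<Longrightarrow> upset {limsup y} \<subseteq> u A"
  unfolding u_def by blast

text \<open>Each tail supremum dominates one of its own terms and hence \<open>b\<close>; the
  infimum over all tails inherits this lower bound.\<close>

lemma u_upset_subset: "u (upset {b}) \<subseteq> upset {b}"
proof
  fix c assume "c \<in> u (upset {b})"
  then obtain y where y: "\<And>n. b \<le> y n" and c: "limsup y \<le> c"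
    unfolding u_def upset_def by auto
  have "b \<le> (SUP n\<in>{k..}. y n)" for k
    by (rule order.trans[OF y[of k]]) (auto intro: SUP_upper)
  then have "b \<le> limsup y"
    unfolding limsup_INF_SUP by (auto intro: INF_greatest)
  with c show "c \<in> upset {b}" unfolding upset_def by auto
qed

text \<open>Stage \<open>A\<close> sits at the least element \<open>z\<close> of
  \<open>omega1\<close>, so stage \<open>u A\<close> sits at its successor, which is still below
  \<omega>1.\<close>

lemma u_subset_cl_omega1: "u A \<subseteq> cl_omega1 A"
proof -
  interpret wo_rel omega1 by (rule wo_rel_omega1)
  define z where "z = minim (Field omega1)"
  have ne: "Field omega1 \<noteq> {}" using infinite_Field_omega1 by auto
  have z: "z \<in> Field omega1" unfolding z_def by (rule minim_in[OF subset_refl ne])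
  have "(z, \<beta>) \<in> omega1" if "\<beta> \<in> Field omega1" for \<beta>
    unfolding z_def using minim_least[OF subset_refl that] .
  then have "Order_Relation.underS omega1 z = {}"
    using ANTISYM unfolding Order_Relation.underS_def antisym_def by (blast intro: FieldI1)
  then have "cl (suc {z}) A = u A" using cl_suc[OF z, of A] by (simp add: cl_zero)
  moreover have "suc {z} \<in> Field omega1"
    using is_successor_suc[OF z] unfolding is_successor_def Order_Relation.underS_def
    by (blast intro: FieldI2)
  ultimately show ?thesis unfolding cl_omega1_def by blast
qed

text \<open>Transfinite induction on the stage: a successor stage stays inside \<open>S\<close> by
  monotonicity of \<open>u\<close>, a limit stage as a union of subsets of \<open>S\<close>.\<close>

lemma cl_omega1_least:
  assumes "A \<subseteq> S" "u S \<subseteq> S"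
  shows "cl_omega1 A \<subseteq> S"
proof -
  have "cl \<alpha> A \<subseteq> S" for \<alpha>
  proof (induction \<alpha> rule: wo_rel.well_order_induct[OF wo_rel_omega1])
    case (1 \<alpha>)
    then have IH: "cl \<beta> A \<subseteq> S" if "\<beta> \<in> underS omega1 \<alpha>" for \<beta>
      using that unfolding underS_def by blast
    consider "underS omega1 \<alpha> = {}" | \<beta> where "is_successor \<alpha> \<beta>"
      | "underS omega1 \<alpha> \<noteq> {}" "\<nexists>\<beta>. is_successor \<alpha> \<beta>" by blast
    then show ?case
    proof cases
      case 1
      then show ?thesis using assms by (simp add: cl_zero)
    next
      case 2
      then have "\<alpha> = wo_rel.suc omega1 {\<beta>}" and \<beta>: "\<beta> \<in> underS omega1 \<alpha>"
        unfolding is_successor_def by blast+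
      moreover have "\<beta> \<in> Field omega1"
        using \<beta> unfolding underS_def by (blast intro: FieldI1)
      ultimately have "cl \<alpha> A = u (cl \<beta> A)" using cl_suc by metis
      then show ?thesis using u_mono[OF IH[OF \<beta>]] assms by blast
    next
      case 3
      then show ?thesis using cl_limit IH by blast
    qed
  qed
  then show ?thesis unfolding cl_omega1_def by blast
qed

text \<open>One sequence in \<open>A\<close> whose \<open>limsup\<close> is a lower bound of
  \<open>A\<close> settles the closure: it gives \<open>upset {b} \<subseteq> u A\<close>, and
  \<open>upset {b}\<close> is already closed under \<open>u\<close>.\<close>

lemma cl_omega1_eq_upset:
  assumes "A \<subseteq> upset {b}" "\<And>n. y n \<in> A" "limsup y = b"
  shows "cl_omega1 A = upset {b}"
proof
  show "cl_omega1 A \<subseteq> upset {b}" using assms(1) u_upset_subset by (rule cl_omega1_least)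
  show "upset {b} \<subseteq> cl_omega1 A"
    using u_I[of y A] u_subset_cl_omega1[of A] assms(2,3) by blast
qed

lemma limsup_decseq:
  fixes a :: "nat \<Rightarrow> 'a::complete_lattice"
  assumes "decseq a"
  shows "limsup a = (INF n. a n)"
proof -
  have "(SUP n\<in>{k..}. a n) = a k" for k
    using assms by (intro antisym SUP_least SUP_upper) (auto simp: decseq_def)
  then show ?thesis unfolding limsup_INF_SUP by simp
qed

text \<open>The \<open>limsup\<close> lies below the tail after \<open>m\<close>, which is disjoint
  from \<open>x m\<close>. So it is disjoint from every term, hence from their supremum, yet it lies
  below that supremum. Writing disjointness as an inequality with a complement lets it pass to
  suprema.\<close>

lemma limsup_disjoint_sequence:
  fixes x :: "nat \<Rightarrow> 'b::{boolean_algebra, complete_lattice}"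
  assumes disj: "\<And>m n. m < n \<Longrightarrow> inf (x m) (x n) = bot"
  shows "limsup x = bot"
proof -
  let ?l = "limsup x"
  have tail: "?l \<le> (SUP n\<in>{k..}. x n)" for k
    unfolding limsup_INF_SUP by (rule INF_lower) simp
  have "x m \<le> - ?l" for m
  proof -
    have "x n \<le> - x m" if "n \<in> {Suc m..}" for n
      using disj[of m n] that by (simp add: inf_shunt[symmetric] inf_commute)
    then have "(SUP n\<in>{Suc m..}. x n) \<le> - x m" by (rule SUP_least)
    with tail[of "Suc m"] have "?l \<le> - x m" by (rule order.trans)
    then show ?thesis using compl_le_swap1 by blast
  qed
  then have "(SUP n\<in>{0..}. x n) \<le> - ?l" by (intro SUP_least)
  with tail[of 0] have "?l \<le> - ?l" by (rule order.trans)
  then show ?thesis by (simp add: inf_shunt[symmetric])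
qed

lemma cl_omega1_infinite_antichain:
  fixes A :: "'b::{boolean_algebra, complete_lattice} set"
  assumes "C \<subseteq> A" "infinite C" "antichain C"
  shows "cl_omega1 A = UNIV"
proof -
  obtain x :: "nat \<Rightarrow> 'b" where x: "inj x" "range x \<subseteq> C"
    using infinite_countable_subset[OF assms(2)] by blast
  have "inf (x m) (x n) = bot" if "m < n" for m n
  proof -
    have "x m \<noteq> x n" using that injD[OF x(1)] by blast
    then show ?thesis using assms(3) x(2) unfolding antichain_def by blast
  qed
  then have "limsup x = bot" by (rule limsup_disjoint_sequence)
  then have "cl_omega1 A = upset {bot}"
    using x assms(1) by (intro cl_omega1_eq_upset) (auto simp: upset_def)
  then show ?thesis by (simp add: upset_def)
qed

text \<open>Some \<open>x\<close> splits \<open>b\<close> properly. Every element below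
  \<open>b\<close> is the join of its parts below \<open>x\<close> and below
  \<open>inf b (- x)\<close>, so these two pieces cannot both have only finitely many elements below
  them.\<close>

lemma infinite_below_shrink:
  fixes b :: "'b::boolean_algebra"
  assumes inf: "infinite {..b}"
  shows "\<exists>c<b. infinite {..c}"
proof -
  obtain x where "x \<in> {..b}" "x \<notin> {bot, b}"
    using inf by (metis finite.emptyI finite.insertI finite_subset subsetI)
  then have x: "x \<le> b" "x \<noteq> bot" "x \<noteq> b" by auto
  let ?y = "inf b (- x)"
  have y: "?y \<noteq> b"
  proof
    assume "?y = b"
    then have "x \<le> - x" using x(1) by (metis inf_le2 order.trans)
    then show False using x(2) by (simp add: inf_shunt[symmetric])
  qed
  have "{..b} \<subseteq> (\<lambda>(p, q). sup p q) ` ({..x} \<times> {..?y})"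
  proof
    fix z assume "z \<in> {..b}"
    then have "z = sup (inf z x) (inf z (- x))" "inf z (- x) \<le> ?y"
      by (auto simp: inf_sup_distrib1[symmetric] intro: le_infI1)
    then show "z \<in> (\<lambda>(p, q). sup p q) ` ({..x} \<times> {..?y})" by force
  qed
  then have "infinite {..x} \<or> infinite {..?y}"
    using inf by (meson finite_SigmaI finite_imageI finite_subset)
  moreover have "x < b" "?y < b" using x y by (simp_all add: less_le)
  ultimately show ?thesis by blast
qed

lemma infinite_boolean_algebra_strict_decseq:
  assumes "infinite (UNIV :: 'b::boolean_algebra set)"
  obtains y :: "nat \<Rightarrow> 'b::boolean_algebra" where "\<And>n. y (Suc n) < y n"
proof -
  \<comment> \<open>Infinitude of \<open>{..y n}\<close> is carried along so that the shrinking step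
    can be repeated; the choice can start at \<open>top\<close>.\<close>
  have "\<exists>y. \<forall>n. infinite {..y n :: 'b} \<and> y (Suc n) < y n"
  proof (rule dependent_nat_choice)
    show "\<exists>b::'b. infinite {..b}" using assms by (metis atMost_eq_UNIV_iff)
  qed (use infinite_below_shrink in blast)
  then show ?thesis using that by blast
qed

lemma dense_subset_infinite_antichain:
  fixes A :: "'b::boolean_algebra set"
  assumes "infinite (UNIV :: 'b set)" "dense_subset A"
  shows "\<exists>C\<subseteq>A. infinite C \<and> antichain C"
proof -
  obtain y :: "nat \<Rightarrow> 'b" where y: "\<And>n. y (Suc n) < y n"
    using infinite_boolean_algebra_strict_decseq[OF assms(1)] by blast
  then have dec: "decseq y" by (simp add: decseq_Suc_iff less_imp_le)
  \<comment> \<open>A zero difference would give \<open>y n \<le> y (Suc n)\<close>.\<close>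
  have "inf (y n) (- y (Suc n)) \<noteq> bot" for n
    using y[of n] by (simp add: inf_shunt leD)
  then have "bot < inf (y n) (- y (Suc n))" for n
    by (simp add: bot.not_eq_extremum)
  then have "\<forall>n. \<exists>c. c \<in> A \<and> bot < c \<and> c \<le> inf (y n) (- y (Suc n))"
    using assms(2) unfolding dense_subset_def by blast
  then obtain x where x: "\<And>n. x n \<in> A" "\<And>n. bot < x n" "\<And>n. x n \<le> inf (y n) (- y (Suc n))"
    by metis
  have less: "inf (x m) (x n) = bot" if "m < n" for m n
  proof -
    \<comment> \<open>The element \<open>y (Suc m)\<close> separates the two terms:
      \<open>x n\<close> lies below it and \<open>x m\<close> below its complement.\<close>
    have "y n \<le> y (Suc m)" using dec that by (simp add: decseq_def)
    then have "x n \<le> y (Suc m)" using x(3)[of n] by (metis le_inf_iff order.trans)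
    moreover have "x m \<le> - y (Suc m)" using x(3)[of m] by simp
    ultimately have "x m \<le> - x n" using compl_mono order.trans by blast
    then show ?thesis by (simp add: inf_shunt)
  qed
  have disj: "inf (x m) (x n) = bot" if "m \<noteq> n" for m n
    using less that by (metis inf_commute nat_neq_iff)
  have "inj x"
    using disj x(2) by (metis injI inf.idem less_irrefl)
  then have "infinite (range x)" by (simp add: finite_image_iff)
  moreover have "antichain (range x)"
    using disj x(2) unfolding antichain_def by (metis imageE less_irrefl)
  moreover have "range x \<subseteq> A" using x(1) by blast
  ultimately show ?thesis by blast
qed

theorem lemma4p7:
  shows "(\<forall>a :: nat \<Rightarrow> 'b::{boolean_algebra, complete_lattice}.
            decseq a \<longrightarrow> cl_omega1 (range a) = upset {INF n. a n})
       \<and> (\<forall>a :: nat \<Rightarrow> 'b. incseq a \<longrightarrow> cl_omega1 (range a) = upset {a 0})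
       \<and> (\<forall>a :: nat \<Rightarrow> 'b. infinite (range a) \<and> antichain (range a)
            \<longrightarrow> cl_omega1 (range a) = UNIV)
       \<and> (\<forall>A :: 'b set. (\<exists>C\<subseteq>A. infinite C \<and> antichain C) \<longrightarrow> cl_omega1 A = UNIV)
       \<and> (infinite (UNIV :: 'b set)
            \<longrightarrow> (\<forall>A :: 'b set. dense_subset A \<longrightarrow> cl_omega1 A = UNIV))"
proof (intro conjI allI impI)
  fix a :: "nat \<Rightarrow> 'b" assume "decseq a"
  then show "cl_omega1 (range a) = upset {INF n. a n}"
    by (intro cl_omega1_eq_upset[of _ _ a] limsup_decseq) (auto simp: upset_def intro: INF_lower)
next
  fix a :: "nat \<Rightarrow> 'b" assume "incseq a"
  then show "cl_omega1 (range a) = upset {a 0}"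
    \<comment> \<open>The constant sequence is the witness, since the \<open>limsup\<close> of
      \<open>a\<close> itself is the supremum of its range, in general above
      \<open>a 0\<close>.\<close>
    by (intro cl_omega1_eq_upset[of _ _ "\<lambda>_. a 0"])
      (auto simp: upset_def incseq_def limsup_INF_SUP)
next
  fix a :: "nat \<Rightarrow> 'b" assume "infinite (range a) \<and> antichain (range a)"
  then show "cl_omega1 (range a) = UNIV"
    using cl_omega1_infinite_antichain by blast
next
  fix A :: "'b set" assume "\<exists>C\<subseteq>A. infinite C \<and> antichain C"
  then show "cl_omega1 A = UNIV"
    using cl_omega1_infinite_antichain by blast
next
  fix A :: "'b set" assume "infinite (UNIV :: 'b set)" "dense_subset A"
  then show "cl_omega1 A = UNIV"
    by (metis dense_subset_infinite_antichain cl_omega1_infinite_antichain)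
qed

end
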